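(* Let $P\subseteq\mathbb{N}$ and let $(\Sigma_P,\sigma_P)$ be the associated spacing shift. Then the topological entropy $h_{\sigma_P}$ equals $0$ if and only if $P=\mathbb{N}\setminus E$ where $E\subseteq\mathbb{N}$ is a density intersective set.
   Context: $\mathbb{N}=\{1,2,3,\dots\}$. Let $\Sigma=\prod_{i=0}^{\infty}\{0,1\}$ be the one-sided full shift on two symbols with shift map $\sigma$, $(\sigma s)_i=s_{i+1}$. For $P\subseteq\mathbb{N}$ the spacing shift is the subshift $\Sigma_P=\{s\in\Sigma:\ s_i=s_j=1\Rightarrow |i-j|\in P\cup\{0\}\}$, and $\sigma_P$ is the restriction of $\sigma$ to $\Sigma_P$; $h_{\sigma_P}$ is its topological entropy. The upper Banach density of $A\subseteq\mathbb{N}$ is $d^*(A)=\limsup_{N-M\to\infty}\frac{|A\cap\{M,M+1,\dots,N\}|}{N-M+1}$, the limsup being over intervals $\{M,\dots,N\}$ of natural numbers with length tending to infinity. For a set $A$, $A-A=\{a-b:\ a,b\in A,\ a>b\}$. A set $E\subseteq\mathbb{N}$ is density intersective if $E\cap(A-A)\neq\emptyset$ for every $A\subseteq\mathbb{N}$ with $d^*(A)>0$. *)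

theory Defs
  imports "HOL-Analysis.Analysis"
begin

text \<open>
  Topological entropy of a continuous self-map \<open>T\<close> of a compact space \<open>X\<close>, following
  Adler, Konheim and McAndrew. Since \<open>T\<close> maps \<open>topspace X\<close> into
  itself, its values outside are irrelevant and no restriction operator is needed.
\<close>

definition open_covers :: "'a topology \<Rightarrow> 'a set set set" where
  "open_covers X = {\<U>. (\<forall>U\<in>\<U>. openin X U) \<and> \<Union>\<U> = topspace X}"

text \<open>The infimum is over a nonempty set of natural numbers, hence a minimum, as soon as \<open>X\<close>
  is compact.\<close>

definition cover_number :: "'a topology \<Rightarrow> 'a set set \<Rightarrow> nat" where
  "cover_number X \<U> = Inf {card \<V> | \<V>. finite \<V> \<and> \<V> \<subseteq> \<U> \<and> \<Union>\<V> = topspace X}"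

text \<open>The join of the preimages of \<open>\<U>\<close> under \<open>T ^^ i\<close> for \<open>i = 0, \<dots>, n - 1\<close>.\<close>

definition iterated_cover ::
    "'a topology \<Rightarrow> ('a \<Rightarrow> 'a) \<Rightarrow> 'a set set \<Rightarrow> nat \<Rightarrow> 'a set set" where
  "iterated_cover X T \<U> n =
     {{x \<in> topspace X. \<forall>i<n. (T ^^ i) x \<in> u i} | u. \<forall>i<n. u i \<in> \<U>}"

text \<open>The sequence below converges, by subadditivity, when \<open>X\<close> is compact and \<open>T\<close> is
  continuous; the limit superior is then its limit.\<close>

definition cover_entropy :: "'a topology \<Rightarrow> ('a \<Rightarrow> 'a) \<Rightarrow> 'a set set \<Rightarrow> ereal" where
  "cover_entropy X T \<U> =
     limsup (\<lambda>n. ereal (ln (real (cover_number X (iterated_cover X T \<U> n))) / real n))"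

definition topological_entropy :: "'a topology \<Rightarrow> ('a \<Rightarrow> 'a) \<Rightarrow> ereal" where
  "topological_entropy X T = (SUP \<U>\<in>open_covers X. cover_entropy X T \<U>)"

text \<open>Symbols are booleans: \<^term>\<open>True\<close> is the symbol 1 and \<^term>\<open>False\<close> the symbol 0.\<close>

definition full_shift :: "(nat \<Rightarrow> bool) topology" where
  "full_shift = product_topology (\<lambda>_. discrete_topology UNIV) UNIV"

definition shift :: "(nat \<Rightarrow> bool) \<Rightarrow> nat \<Rightarrow> bool" where
  "shift s = (\<lambda>i. s (i + 1))"

definition spacing_shift :: "nat set \<Rightarrow> (nat \<Rightarrow> bool) topology" where
  "spacing_shift P = subtopology full_shift
     {s. \<forall>i j. s i \<and> s j \<longrightarrow> nat \<bar>int i - int j\<bar> \<in> P \<union> {0}}"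

lemma topspace_spacing_shift:
  "topspace (spacing_shift P) = {s. \<forall>i j. s i \<and> s j \<longrightarrow> nat \<bar>int i - int j\<bar> \<in> P \<union> {0}}"
  by (simp add: spacing_shift_def full_shift_def topspace_product_topology)

lemma shift_in_spacing_shift:
  assumes "s \<in> topspace (spacing_shift P)"
  shows "shift s \<in> topspace (spacing_shift P)"
proof -
  have "nat \<bar>int i - int j\<bar> \<in> P \<union> {0}" if "s (i + 1)" "s (j + 1)" for i j
  proof -
    have "nat \<bar>int (i + 1) - int (j + 1)\<bar> \<in> P \<union> {0}"
      using assms that unfolding topspace_spacing_shift by blast
    then show ?thesis by simp
  qed
  then show ?thesis
    unfolding topspace_spacing_shift shift_def by blast
qed

lemma continuous_map_shift:
  "continuous_map (spacing_shift P) (spacing_shift P) shift"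
proof -
  have "continuous_map full_shift full_shift shift"
    unfolding full_shift_def shift_def
    by (auto simp: continuous_map_componentwise_UNIV intro: continuous_map_product_projection)
  then have "continuous_map (spacing_shift P) full_shift shift"
    unfolding spacing_shift_def by (rule continuous_map_from_subtopology)
  moreover have "shift ` topspace (spacing_shift P) \<subseteq> topspace (spacing_shift P)"
    using shift_in_spacing_shift by blast
  ultimately show ?thesis
    by (subst (2) spacing_shift_def)
       (auto simp: continuous_map_in_subtopology topspace_spacing_shift)
qed

lemma compact_space_spacing_shift: "compact_space (spacing_shift P)"
proof -
  have comp: "compact_space full_shift"
    unfolding full_shift_def
    by (simp add: compact_space_product_topology compact_space_discrete_topology)
  have clo: "closedin full_shift {s. \<not> s i \<or> \<not> s j}" for i j
  proof -
    have "continuous_map full_shift (discrete_topology UNIV) (\<lambda>s. s k)" for k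
      unfolding full_shift_def by (intro continuous_map_product_projection) simp
    then have "closedin full_shift {s \<in> topspace full_shift. s k \<in> {False}}" for k
      by (rule closedin_continuous_map_preimage) simp
    moreover have "topspace full_shift = UNIV"
      by (simp add: full_shift_def topspace_product_topology)
    ultimately have "closedin full_shift {s. \<not> s k}" for k by simp
    then have "closedin full_shift ({s. \<not> s i} \<union> {s. \<not> s j})" by blast
    moreover have "{s. \<not> s i} \<union> {s. \<not> s j} = {s. \<not> s i \<or> \<not> s j}" by blast
    ultimately show ?thesis by metis
  qed
  let ?I = "{(i, j). nat \<bar>int i - int j\<bar> \<notin> P \<union> {0}}"
  let ?S = "{s. \<forall>i j. s i \<and> s j \<longrightarrow> nat \<bar>int i - int j\<bar> \<in> P \<union> {0}}"
  have "closedin full_shift ?S"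
  proof (cases "?I = {}")
    case True
    then have "?S = topspace full_shift"
      by (auto simp: full_shift_def topspace_product_topology)
    then show ?thesis by (metis closedin_topspace)
  next
    case False
    have "?S = (\<Inter>(i, j)\<in>?I. {s. \<not> s i \<or> \<not> s j})" by auto
    moreover have "closedin full_shift (\<Inter>(i, j)\<in>?I. {s. \<not> s i \<or> \<not> s j})"
      using False clo by (intro closedin_INT) auto
    ultimately show ?thesis by simp
  qed
  then show ?thesis
    unfolding spacing_shift_def
    by (intro compact_space_subtopology closedin_compact_space comp)
qed

text \<open>The positive integers are rendered as the subset \<open>{1..}\<close> of the type \<^typ>\<open>nat\<close>.\<close>

definition upper_banach_density :: "nat set \<Rightarrow> ereal" where
  "upper_banach_density A =
     Limsup (inf (filtercomap (\<lambda>(M, N). N - M) at_top) (principal {(M, N). 1 \<le> M}))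
       (\<lambda>(M, N). ereal (real (card (A \<inter> {M..N})) / real (N - M + 1)))"

definition difference_set :: "nat set \<Rightarrow> nat set" where
  "difference_set A = {a - b | a b. a \<in> A \<and> b \<in> A \<and> a > b}"

definition density_intersective :: "nat set \<Rightarrow> bool" where
  "density_intersective E \<longleftrightarrow>
     E \<subseteq> {1..} \<and>
     (\<forall>A\<subseteq>{1..}. upper_banach_density A > 0 \<longrightarrow> E \<inter> difference_set A \<noteq> {})"

end

theory Submission
  imports Defs
begin

text \<open>
  Call \<open>F \<subseteq> {0, \<dots>, n - 1}\<close> a word of length \<open>n\<close> if its differences lie in \<open>P\<close>. Subsets of words are
  words, so a word of density at least \<open>c\<close> has \<open>2\<^sup>c\<^sup>n\<close> subwords, and such words for arbitrarily large
  \<open>n\<close> force positive entropy. If instead the maximal density of words tends to \<open>0\<close>, there are only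
  \<open>exp (o(n))\<close> words, and by compactness they bound the cover numbers of every open cover. Hence the
  entropy is positive iff there are arbitrarily long words of density at least some fixed \<open>c > 0\<close>.
  A set \<open>A\<close> of positive upper Banach density with all differences in \<open>P\<close> contains such words;
  conversely, from such words one extracts words all of whose prefixes have density at least
  \<open>c / 2\<close>, and a limit point of these in the spacing shift is the required set.
\<close>

section \<open>Words and their difference sets\<close>

definition words :: "nat set \<Rightarrow> nat \<Rightarrow> nat set set" where
  "words P n = {F. F \<subseteq> {..<n} \<and> difference_set F \<subseteq> P}"

lemma finite_words [simp]: "finite (words P n)"
  unfolding words_def by (rule finite_subset[of _ "Pow {..<n}"]) auto

lemma difference_set_mono: "F \<subseteq> G \<Longrightarrow> difference_set F \<subseteq> difference_set G"
  unfolding difference_set_def by blast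

text \<open>Differences are translation invariant. Only an inclusion holds, because elements of
  \<open>F\<close> below \<open>t\<close> are cut off.\<close>

lemma difference_set_vimage_plus: "difference_set {i. t + i \<in> F} \<subseteq> difference_set F"
proof
  fix d assume "d \<in> difference_set {i. t + i \<in> F}"
  then obtain a b where "t + a \<in> F" "t + b \<in> F" "a > b" "d = (t + a) - (t + b)"
    unfolding difference_set_def by auto
  then show "d \<in> difference_set F"
    unfolding difference_set_def by fastforce
qed

lemma difference_set_image_Suc: "difference_set (Suc ` F) = difference_set F"
proof (intro equalityI subsetI)
  fix d assume "d \<in> difference_set F"
  then obtain a b where "Suc a \<in> Suc ` F" "Suc b \<in> Suc ` F" "Suc a > Suc b" "d = Suc a - Suc b"
    unfolding difference_set_def by auto
  then show "d \<in> difference_set (Suc ` F)"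
    unfolding difference_set_def by blast
qed (auto simp: difference_set_def, blast)

text \<open>By symmetry only pairs with \<open>a > b\<close> matter; the pairs with
  \<open>i = j\<close> account for the extra element 0. Points of the spacing shift thereby become
  infinite analogues of words.\<close>

lemma topspace_spacing_shift_iff:
  "s \<in> topspace (spacing_shift P) \<longleftrightarrow> difference_set {i. s i} \<subseteq> P"
proof
  assume s: "s \<in> topspace (spacing_shift P)"
  show "difference_set {i. s i} \<subseteq> P"
  proof
    fix d assume "d \<in> difference_set {i. s i}"
    then obtain a b where ab: "s a" "s b" "a > b" "d = a - b"
      unfolding difference_set_def by blast
    then have "nat \<bar>int a - int b\<bar> \<in> P \<union> {0}"
      using s unfolding topspace_spacing_shift by blast
    moreover have "nat \<bar>int a - int b\<bar> = d" "d \<noteq> 0" using ab by auto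
    ultimately show "d \<in> P" by simp
  qed
next
  assume d: "difference_set {i. s i} \<subseteq> P"
  have "nat \<bar>int i - int j\<bar> \<in> P \<union> {0}" if "s i" "s j" for i j
  proof (cases i j rule: linorder_cases)
    case less
    then have "j - i \<in> P" using d that unfolding difference_set_def by blast
    moreover have "nat \<bar>int i - int j\<bar> = j - i" using less by auto
    ultimately show ?thesis by (metis UnI1)
  next
    case greater
    then have "i - j \<in> P" using d that unfolding difference_set_def by blast
    moreover have "nat \<bar>int i - int j\<bar> = i - j" using greater by auto
    ultimately show ?thesis by (metis UnI1)
  qed auto
  then show "s \<in> topspace (spacing_shift P)"
    unfolding topspace_spacing_shift by blast
qed

lemma shift_funpow: "(shift ^^ i) s = (\<lambda>j. s (j + i))"
  by (induction i arbitrary: s) (auto simp: shift_def)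

section \<open>Cylinders and compactness\<close>

lemma openin_full_shift_finitely_determined:
  assumes "\<And>s t. s \<in> S \<Longrightarrow> (\<And>i. i < m \<Longrightarrow> s i = t i) \<Longrightarrow> t \<in> S"
  shows "openin full_shift S"
  unfolding full_shift_def openin_product_topology_alt
proof
  fix s assume "s \<in> S"
  let ?U = "\<lambda>i. if i < m then {s i} else UNIV"
  have "Pi\<^sub>E UNIV ?U \<subseteq> S"
  proof
    fix t assume "t \<in> Pi\<^sub>E UNIV ?U"
    then have "t i \<in> ?U i" for i by (rule PiE_mem) simp
    then have "s i = t i" if "i < m" for i
      using that by (metis singletonD)
    then show "t \<in> S" using assms \<open>s \<in> S\<close> by blast
  qed
  moreover have "finite {i \<in> UNIV. ?U i \<noteq> topspace (discrete_topology UNIV)}"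
    by (rule finite_subset[of _ "{..<m}"]) auto
  ultimately show "\<exists>U. finite {i \<in> UNIV. U i \<noteq> topspace (discrete_topology UNIV)} \<and>
      (\<forall>i\<in>UNIV. openin (discrete_topology UNIV) (U i)) \<and> s \<in> Pi\<^sub>E UNIV U \<and> Pi\<^sub>E UNIV U \<subseteq> S"
    by (intro exI[of _ ?U]) auto
qed

lemma openin_full_shift_imp_cylinder:
  assumes "openin full_shift S" "s \<in> S"
  obtains m where "{t. \<forall>i<m. t i = s i} \<subseteq> S"
proof -
  obtain U :: "nat \<Rightarrow> bool set" where U: "finite {i. U i \<noteq> UNIV}" "s \<in> Pi\<^sub>E UNIV U" "Pi\<^sub>E UNIV U \<subseteq> S"
    using assms unfolding full_shift_def openin_product_topology_alt by (auto; blast)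
  obtain m where m: "{i. U i \<noteq> UNIV} \<subseteq> {..<m}"
    using U(1) unfolding finite_nat_iff_bounded by auto
  have "{t. \<forall>i<m. t i = s i} \<subseteq> Pi\<^sub>E UNIV U"
  proof clarify
    fix t assume t: "\<forall>i<m. t i = s i"
    have "t i \<in> U i" for i
    proof (cases "i < m")
      case True
      then show ?thesis using t PiE_mem[OF U(2), of i] by simp
    next
      case False
      then have "U i = UNIV" using m by blast
      then show ?thesis by simp
    qed
    then show "t \<in> Pi\<^sub>E UNIV U" by auto
  qed
  then show thesis by (intro that[of m]) (rule subset_trans[OF _ U(3)])
qed

text \<open>The compactness argument, applied below both to open covers and to dense prefixes. A
  condition on the first \<open>K\<close> coordinates is closed, since its complement is a union of
  cylinders, so Cantor's intersection theorem applies.\<close>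

lemma spacing_shift_nested_nonempty:
  assumes det: "\<And>K s t. s \<in> C K \<Longrightarrow> (\<And>i. i < K \<Longrightarrow> s i = t i) \<Longrightarrow> t \<in> C K"
    and ne: "\<And>K. \<exists>s \<in> topspace (spacing_shift P). s \<in> C K"
    and dec: "decseq C"
  shows "\<exists>s \<in> topspace (spacing_shift P). \<forall>K. s \<in> C K"
proof -
  let ?X = "spacing_shift P"
  have "closedin ?X (C K \<inter> topspace ?X)" for K
  proof -
    have "openin full_shift (- C K)"
      by (rule openin_full_shift_finitely_determined[of _ K]) (metis det ComplD ComplI)
    then have "openin ?X (- C K \<inter> topspace ?X)"
      unfolding spacing_shift_def openin_subtopology
      by (auto simp: full_shift_def topspace_product_topology)
    moreover have "topspace ?X - C K \<inter> topspace ?X = - C K \<inter> topspace ?X" by blast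
    ultimately show ?thesis unfolding closedin_def by simp
  qed
  moreover have "C K \<inter> topspace ?X \<noteq> {}" for K using ne[of K] by blast
  moreover have "decseq (\<lambda>K. C K \<inter> topspace ?X)"
    using dec unfolding decseq_def by blast
  ultimately have "(\<Inter>K. C K \<inter> topspace ?X) \<noteq> {}"
    by (intro compact_space_imp_nest[OF compact_space_spacing_shift[of P]]) auto
  then show ?thesis by blast
qed

text \<open>A Lebesgue number for the cover. If every \<open>m\<close> failed, the nested sets of
  points whose \<open>m\<close>-cylinder fits into no member would have a common point; but that
  point has a cylinder inside the member containing it.\<close>

lemma open_cover_cylinder_refinement:
  assumes "\<U> \<in> open_covers (spacing_shift P)"
  obtains m where "\<And>w. \<exists>U\<in>\<U>. {t \<in> topspace (spacing_shift P). \<forall>i<m. t i = w i} \<subseteq> U"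
proof -
  let ?X = "spacing_shift P"
  define cyl where "cyl m s = {t \<in> topspace ?X. \<forall>i<m. t i = s i}" for m and s :: "nat \<Rightarrow> bool"
  have op: "\<And>U. U \<in> \<U> \<Longrightarrow> openin ?X U" and cov: "\<Union>\<U> = topspace ?X"
    using assms unfolding open_covers_def by auto
  have zero: "(\<lambda>_. False) \<in> topspace ?X"
    by (simp add: topspace_spacing_shift)
  have "\<exists>m. \<forall>s\<in>topspace ?X. \<exists>U\<in>\<U>. cyl m s \<subseteq> U"
  proof (rule ccontr)
    assume contra: "\<not> ?thesis"
    let ?C = "\<lambda>m. {s. \<forall>U\<in>\<U>. \<not> cyl m s \<subseteq> U}"
    have "\<exists>s \<in> topspace ?X. \<forall>m. s \<in> ?C m"
    proof (rule spacing_shift_nested_nonempty)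
      fix K and s t :: "nat \<Rightarrow> bool"
      assume s: "s \<in> ?C K" and "\<And>i. i < K \<Longrightarrow> s i = t i"
      then have "cyl K s = cyl K t" unfolding cyl_def by (intro Collect_cong) auto
      with s show "t \<in> ?C K" by (simp only: mem_Collect_eq)
    next
      fix K show "\<exists>s \<in> topspace ?X. s \<in> ?C K" using contra by blast
    next
      show "decseq ?C"
        unfolding decseq_def
      proof (intro allI impI subsetI CollectI ballI)
        fix m n s U assume "m \<le> n" and s: "s \<in> ?C n" and "U \<in> \<U>"
        then have "cyl n s \<subseteq> cyl m s" unfolding cyl_def by auto
        with s \<open>U \<in> \<U>\<close> show "\<not> cyl m s \<subseteq> U" by blast
      qed
    qed
    then obtain s where s: "s \<in> topspace ?X" "\<And>m U. U \<in> \<U> \<Longrightarrow> \<not> cyl m s \<subseteq> U" by blast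
    then obtain U where U: "U \<in> \<U>" "s \<in> U" using cov by blast
    obtain T where T: "openin full_shift T" "U = T \<inter> topspace ?X"
      using op[OF U(1)] unfolding spacing_shift_def openin_subtopology
      by (auto simp: full_shift_def topspace_product_topology)
    then obtain m where "{t. \<forall>i<m. t i = s i} \<subseteq> T"
      using openin_full_shift_imp_cylinder[of T s] U by blast
    then have "cyl m s \<subseteq> U" using T unfolding cyl_def by blast
    then show False using s U by blast
  qed
  then obtain m where m: "\<And>s. s \<in> topspace ?X \<Longrightarrow> \<exists>U\<in>\<U>. cyl m s \<subseteq> U" by blast
  \<comment> \<open>An arbitrary \<open>w\<close> may have an empty cylinder. Then any member of the
    cover serves, and one exists because the zero sequence is covered.\<close>
  have "\<exists>U\<in>\<U>. cyl m w \<subseteq> U" for w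
  proof (cases "cyl m w = {}")
    case True
    then show ?thesis using zero cov by blast
  next
    case False
    then obtain s where s: "s \<in> topspace ?X" "\<forall>i<m. s i = w i" unfolding cyl_def by blast
    then have "cyl m s = cyl m w" unfolding cyl_def by (intro Collect_cong) auto
    then show ?thesis using m[OF s(1)] by simp
  qed
  then show thesis unfolding cyl_def by (rule that)
qed

section \<open>Upper bound for cover numbers by counting words\<close>

text \<open>For \<open>i < n\<close> the first \<open>m\<close> symbols of the \<open>i\<close>-th
  shift of \<open>x\<close> sit at positions below \<open>n + m\<close>. Hence the word of
  \<open>x\<close> of length \<open>n + m\<close> selects one member of the cover for each
  \<open>i\<close>, and so one member of the iterated cover containing \<open>x\<close>.\<close>

lemma iterated_cover_subcover:
  assumes "\<U> \<in> open_covers (spacing_shift P)"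
  obtains m where "\<And>n. \<exists>\<V>. finite \<V> \<and> \<V> \<subseteq> iterated_cover (spacing_shift P) shift \<U> n \<and>
      \<Union>\<V> = topspace (spacing_shift P) \<and> card \<V> \<le> card (words P (n + m))"
proof -
  let ?X = "spacing_shift P"
  obtain m where m: "\<And>w. \<exists>U\<in>\<U>. {t \<in> topspace ?X. \<forall>i<m. t i = w i} \<subseteq> U"
    using that by (rule open_cover_cylinder_refinement[OF assms])
  define u where "u w = (SOME U. U \<in> \<U> \<and> {t \<in> topspace ?X. \<forall>i<m. t i = w i} \<subseteq> U)" for w
  have u: "u w \<in> \<U>" "{t \<in> topspace ?X. \<forall>i<m. t i = w i} \<subseteq> u w" for w
    using someI_ex[OF m[of w, unfolded Bex_def]] unfolding u_def by auto
  have "\<exists>\<V>. finite \<V> \<and> \<V> \<subseteq> iterated_cover ?X shift \<U> n \<and>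
      \<Union>\<V> = topspace ?X \<and> card \<V> \<le> card (words P (n + m))" for n
  proof -
    define g where "g F = {x \<in> topspace ?X. \<forall>i<n. (shift ^^ i) x \<in> u (\<lambda>j. j + i \<in> F)}" for F
    have "g F \<in> iterated_cover ?X shift \<U> n" for F
      unfolding iterated_cover_def g_def using u(1)
      by (auto intro!: exI[of _ "\<lambda>i. u (\<lambda>j. j + i \<in> F)"])
    moreover have "x \<in> \<Union>(g ` words P (n + m))" if x: "x \<in> topspace ?X" for x
    proof -
      let ?F = "{i. x i} \<inter> {..<n + m}"
      have "?F \<in> words P (n + m)"
        using x difference_set_mono[of ?F "{i. x i}"]
        unfolding words_def topspace_spacing_shift_iff by auto
      moreover have "x \<in> g ?F"
      proof -
        have "(shift ^^ i) x \<in> u (\<lambda>j. j + i \<in> ?F)" if "i < n" for i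
        proof -
          have "(shift ^^ i) x \<in> topspace ?X"
            using x by (induction i) (auto intro: shift_in_spacing_shift)
          then show ?thesis using that
            by (intro subsetD[OF u(2)]) (auto simp: shift_funpow)
        qed
        then show ?thesis using x unfolding g_def by blast
      qed
      ultimately show ?thesis by blast
    qed
    moreover have "g F \<subseteq> topspace ?X" for F unfolding g_def by blast
    moreover have "card (g ` words P (n + m)) \<le> card (words P (n + m))"
      by (rule card_image_le) simp
    ultimately show ?thesis
      by (intro exI[of _ "g ` words P (n + m)"] conjI equalityI) (simp, blast+)
  qed
  then show thesis by (rule that)
qed

lemma cover_number_le_card_words:
  assumes "\<U> \<in> open_covers (spacing_shift P)"
  obtains m where
    "\<And>n. cover_number (spacing_shift P) (iterated_cover (spacing_shift P) shift \<U> n)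
      \<le> card (words P (n + m))"
proof -
  let ?X = "spacing_shift P"
  obtain m where m: "\<And>n. \<exists>\<V>. finite \<V> \<and> \<V> \<subseteq> iterated_cover ?X shift \<U> n \<and>
      \<Union>\<V> = topspace ?X \<and> card \<V> \<le> card (words P (n + m))"
    using that by (rule iterated_cover_subcover[OF assms])
  have "cover_number ?X (iterated_cover ?X shift \<U> n) \<le> card (words P (n + m))" for n
  proof -
    obtain \<V> where "finite \<V>" "\<V> \<subseteq> iterated_cover ?X shift \<U> n"
      "\<Union>\<V> = topspace ?X" and le: "card \<V> \<le> card (words P (n + m))"
      using m[of n] by (elim exE conjE)
    then have "cover_number ?X (iterated_cover ?X shift \<U> n) \<le> card \<V>"
      unfolding cover_number_def by (intro cInf_lower) auto
    with le show ?thesis by linarith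
  qed
  then show thesis by (rule that)
qed

section \<open>Lower bound for cover numbers by subsets of a word\<close>

text \<open>The clopen partition by the symbol at position 0. The nonempty members of its iterated
  covers are the cylinders of length \<open>n\<close>, so it separates distinct words.\<close>

definition zero_cover :: "nat set \<Rightarrow> (nat \<Rightarrow> bool) set set" where
  "zero_cover P = (\<lambda>b. {s \<in> topspace (spacing_shift P). s 0 = b}) ` UNIV"

lemma zero_cover_open: "zero_cover P \<in> open_covers (spacing_shift P)"
proof -
  have "openin (spacing_shift P) {s \<in> topspace (spacing_shift P). s 0 = b}" for b
  proof -
    have "openin full_shift {s. s 0 = b}"
      by (rule openin_full_shift_finitely_determined[of _ 1]) auto
    then show ?thesis
      unfolding spacing_shift_def openin_subtopology
      by (auto simp: full_shift_def topspace_product_topology)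
  qed
  then show ?thesis unfolding open_covers_def zero_cover_def by auto
qed

text \<open>Indicators of subsets of \<open>F\<close> are points of the spacing shift that differ
  pairwise below \<open>n\<close>, so no two share a member of the iterated cover.\<close>

lemma zero_cover_number_ge:
  assumes F: "F \<in> words P n"
  shows "2 ^ card F \<le>
    cover_number (spacing_shift P) (iterated_cover (spacing_shift P) shift (zero_cover P) n)"
  unfolding cover_number_def
proof (rule cInf_greatest)
  let ?X = "spacing_shift P"
  let ?I = "iterated_cover ?X shift (zero_cover P) n"
  \<comment> \<open>The infimum can be bounded from below only over a nonempty set, so a finite
    subcover has to be exhibited first.\<close>
  obtain m where m: "\<And>n. \<exists>\<V>. finite \<V> \<and> \<V> \<subseteq> iterated_cover ?X shift (zero_cover P) n \<and>
      \<Union>\<V> = topspace ?X \<and> card \<V> \<le> card (words P (n + m))"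
    using that by (rule iterated_cover_subcover[OF zero_cover_open])
  obtain \<W> where "finite \<W>" "\<W> \<subseteq> ?I" "\<Union>\<W> = topspace ?X"
    using m[of n] by (elim exE conjE)
  then have "card \<W> \<in> {card \<V> |\<V>. finite \<V> \<and> \<V> \<subseteq> ?I \<and> \<Union>\<V> = topspace ?X}"
    by (intro CollectI exI[of _ \<W>] conjI refl)
  then show "{card \<V> |\<V>. finite \<V> \<and> \<V> \<subseteq> ?I \<and> \<Union>\<V> = topspace ?X} \<noteq> {}"
    by (rule ex_in_conv[THEN iffD1, OF exI])
  fix k assume "k \<in> {card \<V> |\<V>. finite \<V> \<and> \<V> \<subseteq> ?I \<and> \<Union>\<V> = topspace ?X}"
  then obtain \<V> where \<V>: "finite \<V>" "\<V> \<subseteq> ?I" "\<Union>\<V> = topspace ?X" "k = card \<V>"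
    by (elim CollectE exE conjE)
  define v where "v G = (SOME V. V \<in> \<V> \<and> (\<lambda>i. i \<in> G) \<in> V)" for G
  have v: "v G \<in> \<V>" "(\<lambda>i. i \<in> G) \<in> v G" if "G \<subseteq> F" for G
  proof -
    have "(\<lambda>i. i \<in> G) \<in> topspace ?X"
      using F difference_set_mono[OF that]
      unfolding topspace_spacing_shift_iff words_def by auto
    then have "\<exists>V. V \<in> \<V> \<and> (\<lambda>i. i \<in> G) \<in> V" unfolding \<V>(3)[symmetric] by (elim UnionE) (intro exI conjI)
    then show "v G \<in> \<V>" "(\<lambda>i. i \<in> G) \<in> v G"
      unfolding v_def by (rule someI2_ex, simp)+
  qed
  have agree: "x i = y i" if "V \<in> \<V>" "x \<in> V" "y \<in> V" "i < n" for V x y i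
  proof -
    have "V \<in> ?I" using \<V>(2) \<open>V \<in> \<V>\<close> by (rule subsetD)
    then obtain u where u: "V = {x \<in> topspace ?X. \<forall>i<n. (shift ^^ i) x \<in> u i}"
      "\<forall>i<n. u i \<in> zero_cover P"
      unfolding iterated_cover_def by (elim CollectE exE conjE)
    have "u i \<in> zero_cover P" using u(2) \<open>i < n\<close> by simp
    then obtain b where b: "u i = {s \<in> topspace ?X. s 0 = b}"
      unfolding zero_cover_def by (elim imageE)
    have z: "z i = b" if "z \<in> V" for z
    proof -
      have "(shift ^^ i) z \<in> u i" using that u(1) \<open>i < n\<close> by simp
      then show ?thesis unfolding b by (simp add: shift_funpow)
    qed
    show ?thesis using z[OF that(2)] z[OF that(3)] by simp
  qed
  have "inj_on v (Pow F)"
  proof (rule inj_onI)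
    fix G H assume GH: "G \<in> Pow F" "H \<in> Pow F" "v G = v H"
    have "(i \<in> G) = (i \<in> H)" if "i < n" for i
      using agree[OF v(1) v(2), of G "\<lambda>i. i \<in> H" i] v(2)[of H] GH that by simp
    moreover have "F \<subseteq> {..<n}" using F unfolding words_def by blast
    ultimately show "G = H" using GH by blast
  qed
  moreover have "v ` Pow F \<subseteq> \<V>" using v(1) by blast
  ultimately have "card (Pow F) \<le> card \<V>" using card_inj_on_le \<V>(1) by blast
  moreover have "finite F" using F unfolding words_def by (auto intro: finite_subset)
  ultimately show "2 ^ card F \<le> k" using \<V>(4) by (simp add: card_Pow)
qed

section \<open>Entropy and the density of words\<close>

text \<open>A Chernoff-type bound: every word \<open>F\<close> is counted with weight \<open>x ^ card F\<close>, and all subsets of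
  \<open>{..<n}\<close> together have weight \<open>(1 + x) ^ n\<close>.\<close>

lemma card_words_subexponential:
  fixes \<epsilon> :: real
  assumes sparse: "\<And>c::real. c > 0 \<Longrightarrow> \<exists>K. \<forall>n\<ge>K. \<forall>F\<in>words P n. real (card F) < c * n"
    and "\<epsilon> > 0"
  shows "\<exists>K. \<forall>n\<ge>K. real (card (words P n)) \<le> exp (\<epsilon> * n)"
proof -
  \<comment> \<open>\<open>x \<le> \<epsilon> / 2\<close> bounds the total weight by
    \<open>exp (\<epsilon> / 2 * n)\<close>; \<open>x \<le> 1\<close> makes powers of
    \<open>x\<close> decrease in the exponent.\<close>
  define x where "x = min 1 (\<epsilon> / 2)"
  have x: "0 < x" "x \<le> 1" "x \<le> \<epsilon> / 2" using assms(2) unfolding x_def by auto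
  have lnx: "ln x \<le> 0" using x by simp
  \<comment> \<open>Chosen so that each word has weight at least
    \<open>exp (- \<epsilon> / 2 * n)\<close>. The summand 1 keeps the denominator positive when
    \<open>x = 1\<close>.\<close>
  define c where "c = \<epsilon> / (2 * (1 - ln x))"
  have "c > 0" unfolding c_def using assms(2) lnx by (intro divide_pos_pos) auto
  have "c * (1 - ln x) = \<epsilon> / 2" unfolding c_def using lnx by (simp add: field_simps)
  then have c: "- c * ln x \<le> \<epsilon> / 2" using \<open>c > 0\<close> by (simp add: algebra_simps)
  obtain K where K: "\<And>n F. n \<ge> K \<Longrightarrow> F \<in> words P n \<Longrightarrow> real (card F) < c * n"
    using sparse[OF \<open>c > 0\<close>] by blast
  have "real (card (words P n)) \<le> exp (\<epsilon> * n)" if "n \<ge> K" for n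
  proof -
    have "x powr (c * n) * real (card (words P n)) = (\<Sum>F\<in>words P n. x powr (c * n))" by simp
    also have "\<dots> \<le> (\<Sum>F\<in>words P n. x ^ card F)"
    proof (rule sum_mono)
      fix F assume "F \<in> words P n"
      then have "x powr (c * n) \<le> x powr real (card F)"
        using K that x by (intro powr_mono') (auto simp: less_imp_le)
      then show "x powr (c * n) \<le> x ^ card F" using x by (simp add: powr_realpow)
    qed
    also have "\<dots> \<le> (\<Sum>F\<in>Pow {..<n}. x ^ card F)"
      using x by (intro sum_mono2) (auto simp: words_def)
    also have "\<dots> = (\<Prod>i\<in>{..<n}. x + 1)"
      by (subst prod_add) auto
    also have "\<dots> = (1 + x) ^ n" by (simp add: add.commute)
    also have "\<dots> \<le> exp x ^ n" using x by (intro power_mono exp_ge_add_one_self) auto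
    also have "\<dots> = exp (x * n)" by (simp add: exp_of_nat2_mult)
    finally have "real (card (words P n)) \<le> exp (x * n) / x powr (c * n)"
      using x by (simp add: field_simps)
    also have "\<dots> = exp (x * n + (- c * ln x) * n)"
      using x by (simp add: powr_def exp_diff algebra_simps)
    also have "\<dots> \<le> exp (\<epsilon> * n)"
    proof -
      have "x * n + (- c * ln x) * n \<le> \<epsilon> / 2 * n + \<epsilon> / 2 * n"
        using x c by (intro add_mono mult_right_mono) auto
      then show ?thesis by (simp add: field_simps)
    qed
    finally show ?thesis .
  qed
  then show ?thesis by blast
qed

lemma cover_entropy_le_0:
  assumes sparse: "\<And>c::real. c > 0 \<Longrightarrow> \<exists>K. \<forall>n\<ge>K. \<forall>F\<in>words P n. real (card F) < c * n"
    and \<U>: "\<U> \<in> open_covers (spacing_shift P)"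
  shows "cover_entropy (spacing_shift P) shift \<U> \<le> 0"
proof (rule ereal_le_epsilon2)
  fix e :: real assume "e > 0"
  let ?N = "\<lambda>n. cover_number (spacing_shift P) (iterated_cover (spacing_shift P) shift \<U> n)"
  obtain m where m: "\<And>n. ?N n \<le> card (words P (n + m))"
    using that by (rule cover_number_le_card_words[OF \<U>])
  \<comment> \<open>The rate \<open>e / 2\<close> absorbs the extra length \<open>m\<close>, as
    \<open>n + m \<le> 2 * n\<close> once \<open>n \<ge> m\<close>.\<close>
  obtain K where K: "\<And>n. n \<ge> K \<Longrightarrow> real (card (words P n)) \<le> exp (e / 2 * n)"
    using card_words_subexponential[OF sparse, of "e / 2"] \<open>e > 0\<close> by auto
  have "ln (real (?N n)) / n \<le> e" if n: "n \<ge> K" "n \<ge> m" "n > 0" for n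
  proof (cases "?N n = 0")
    case True
    then show ?thesis using \<open>e > 0\<close> by simp
  next
    case False
    have "real (?N n) \<le> real (card (words P (n + m)))" using m by simp
    also have "\<dots> \<le> exp (e / 2 * real (n + m))" using n by (intro K) simp
    also have "\<dots> \<le> exp (e * n)" using n \<open>e > 0\<close> by (simp add: field_simps)
    finally have "ln (real (?N n)) \<le> ln (exp (e * n))"
      using False by (subst ln_le_cancel_iff) auto
    then show ?thesis using n by (simp add: field_simps)
  qed
  then have "\<forall>\<^sub>F n in sequentially. ereal (ln (real (?N n)) / real n) \<le> ereal e"
    unfolding eventually_sequentially
    by (intro exI[of _ "max (max K m) 1"]) auto
  then show "cover_entropy (spacing_shift P) shift \<U> \<le> 0 + ereal e"
    unfolding cover_entropy_def by (simp add: Limsup_bounded)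
qed

lemma cover_entropy_nonneg: "0 \<le> cover_entropy X T \<U>"
proof -
  \<comment> \<open>This includes \<open>k = 0\<close>, where \<open>ln 0 = 0\<close> by
    convention.\<close>
  have "0 \<le> ln (real k)" for k by (cases k) auto
  then show ?thesis unfolding cover_entropy_def
    by (intro le_Limsup) auto
qed

lemma topological_entropy_eq_0I:
  assumes "\<And>\<U>. \<U> \<in> open_covers X \<Longrightarrow> cover_entropy X T \<U> \<le> 0"
  shows "topological_entropy X T = 0"
proof (rule antisym)
  \<comment> \<open>Some open cover is needed, since the supremum of the empty set in
    \<open>ereal\<close> is minus infinity.\<close>
  have "{topspace X} \<in> open_covers X" unfolding open_covers_def by auto
  then show "0 \<le> topological_entropy X T"
    unfolding topological_entropy_def
    by (rule SUP_upper2) (rule cover_entropy_nonneg)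
  show "topological_entropy X T \<le> 0"
    unfolding topological_entropy_def using assms by (rule SUP_least)
qed

text \<open>The partition \<open>zero_cover P\<close> alone has entropy at least
  \<open>c * ln 2\<close>. Arbitrarily large \<open>n\<close> suffice because the entropy of a cover
  is a limit superior.\<close>

lemma topological_entropy_pos:
  fixes c :: real
  assumes "c > 0" and dense: "\<And>K. \<exists>n\<ge>K. \<exists>F\<in>words P n. c * n \<le> card F"
  shows "topological_entropy (spacing_shift P) shift > 0"
proof (rule ccontr)
  let ?X = "spacing_shift P"
  let ?N = "\<lambda>n. cover_number ?X (iterated_cover ?X shift (zero_cover P) n)"
  assume "\<not> ?thesis"
  moreover have "cover_entropy ?X shift (zero_cover P) \<le> topological_entropy ?X shift"
    unfolding topological_entropy_def by (rule SUP_upper[OF zero_cover_open])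
  ultimately have "cover_entropy ?X shift (zero_cover P) \<le> 0" by simp
  also have "0 < ereal (c * ln 2)" using \<open>c > 0\<close> by simp
  finally have "\<forall>\<^sub>F n in sequentially. ereal (ln (real (?N n)) / real n) < ereal (c * ln 2)"
    unfolding cover_entropy_def by (rule Limsup_lessD)
  then obtain K where K: "\<And>n. n \<ge> K \<Longrightarrow> ln (real (?N n)) / real n < c * ln 2"
    unfolding eventually_sequentially by auto
  obtain n F where n: "n \<ge> max K 1" "F \<in> words P n" "c * n \<le> card F"
    using dense[of "max K 1"] by blast
  have "2 ^ card F \<le> ?N n" using zero_cover_number_ge n by blast
  then have N: "(2::real) ^ card F \<le> real (?N n)"
    by (metis of_nat_le_iff of_nat_numeral of_nat_power)
  have "c * n * ln 2 \<le> card F * ln 2" using n by (intro mult_right_mono) auto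
  also have "\<dots> = ln ((2::real) ^ card F)" by (simp add: ln_realpow)
  also have "\<dots> \<le> ln (real (?N n))"
    using N less_le_trans[OF _ N, of 0] by (subst ln_le_cancel_iff) auto
  finally have "c * ln 2 \<le> ln (real (?N n)) / n" using n by (simp add: field_simps)
  with K[of n] n show False by simp
qed

section \<open>From dense words to a point with dense prefixes\<close>

text \<open>Read contrapositively: a set of density well above \<open>c\<close> on a long interval has a point from
  which all blocks of length at most \<open>K\<close> have density above \<open>c\<close>.\<close>

lemma card_le_of_sparse_blocks:
  fixes c :: real and K t n :: nat
  assumes "c \<ge> 0"
    and blocks: "\<And>t. \<exists>k\<in>{1..K}. card (F \<inter> {t..<t + k}) \<le> c * k"
    and "t \<le> n"
  shows "card (F \<inter> {t..<n}) \<le> c * real (n - t) + K"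
  using \<open>t \<le> n\<close>
\<comment> \<open>Sparse blocks are cut off from the left, each of positive length, until at most
  \<open>K\<close> positions remain; these give the additive \<open>K\<close>.\<close>
proof (induction "n - t" arbitrary: t rule: less_induct)
  case less
  show ?case
  proof (cases "n - t \<le> K")
    case True
    have "card (F \<inter> {t..<n}) \<le> card {t..<n}" by (intro card_mono) auto
    then have "real (card (F \<inter> {t..<n})) \<le> K" using True by simp
    moreover have "0 \<le> c * real (n - t)" using assms(1) by simp
    ultimately show ?thesis by linarith
  next
    case False
    obtain k where k: "1 \<le> k" "k \<le> K" "card (F \<inter> {t..<t + k}) \<le> c * k"
      using blocks[of t] by auto
    have "F \<inter> {t..<n} = (F \<inter> {t..<t + k}) \<union> (F \<inter> {t + k..<n})"
      using k False by auto
    then have "card (F \<inter> {t..<n}) \<le> card (F \<inter> {t..<t + k}) + card (F \<inter> {t + k..<n})"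
      by (metis card_Un_le)
    moreover have "card (F \<inter> {t + k..<n}) \<le> c * real (n - (t + k)) + K"
      using less k False by (intro less(1)) auto
    moreover have "c * real (n - (t + k)) + c * k = c * real (n - t)"
      using k False by (simp add: of_nat_diff algebra_simps)
    ultimately show ?thesis using k by linarith
  qed
qed

lemma card_vimage_plus: "card ({i. t + i \<in> F} \<inter> {..<k}) = card (F \<inter> {t..<t + k::nat})"
proof -
  have "(+) t ` ({i. t + i \<in> F} \<inter> {..<k}) = F \<inter> {t..<t + k}"
  proof (intro equalityI subsetI)
    fix x assume "x \<in> F \<inter> {t..<t + k}"
    then show "x \<in> (+) t ` ({i. t + i \<in> F} \<inter> {..<k})"
      by (intro image_eqI[of _ _ "x - t"]) auto
  qed auto
  then show ?thesis by (metis card_image inj_on_add)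
qed

text \<open>Bounding all prefixes up to length \<open>K\<close> is a closed condition on the first
  \<open>K\<close> coordinates. It therefore suffices to find a point for each \<open>K\<close>
  separately, namely a translate of a long dense word.\<close>

lemma uniformly_dense_point:
  fixes c :: real
  assumes "c > 0" and dense: "\<And>K. \<exists>n\<ge>K. \<exists>F\<in>words P n. c * n \<le> card F"
  shows "\<exists>s\<in>topspace (spacing_shift P). \<forall>k. c / 2 * k \<le> card ({i. s i} \<inter> {..<k})"
proof -
  let ?C = "\<lambda>K::nat. {s :: nat \<Rightarrow> bool. \<forall>k\<le>K. c / 2 * k \<le> card ({i. s i} \<inter> {..<k})}"
  have "\<exists>s\<in>topspace (spacing_shift P). \<forall>K. s \<in> ?C K"
  proof (rule spacing_shift_nested_nonempty)
    fix K and s t :: "nat \<Rightarrow> bool"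
    assume s: "s \<in> ?C K" and eq: "\<And>i. i < K \<Longrightarrow> s i = t i"
    have "{i. s i} \<inter> {..<k} = {i. t i} \<inter> {..<k}" if "k \<le> K" for k
      using eq that by fastforce
    then show "t \<in> ?C K" using s by simp
  next
    show "decseq ?C" unfolding decseq_def by auto
  next
    fix K :: nat
    \<comment> \<open>The length makes \<open>c * n\<close> exceed \<open>c / 2 * n + K\<close>, the
      most that \<open>F\<close> could contain if a sparse block of length at most \<open>K\<close>
      started at every position. Halving \<open>c\<close> makes room for the
      \<open>K\<close>.\<close>
    obtain n F where n: "n \<ge> nat \<lceil>2 * K / c\<rceil> + 1" "F \<in> words P n" "c * n \<le> card F"
      using dense by blast
    have "2 * K / c < n" using n(1) by linarith
    then have Kn: "K < c / 2 * n" using \<open>c > 0\<close> by (simp add: field_simps)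
    have "F \<inter> {0..<n} = F" using n(2) unfolding words_def by auto
    then have "\<not> card (F \<inter> {0..<n}) \<le> c / 2 * real (n - 0) + K" using n(3) Kn by simp
    then have "\<not> (\<forall>t. \<exists>k\<in>{1..K}. card (F \<inter> {t..<t + k}) \<le> c / 2 * real k)"
      using card_le_of_sparse_blocks[of "c / 2" K F 0 n] \<open>c > 0\<close> by auto
    then obtain t where t: "\<And>k. k \<in> {1..K} \<Longrightarrow> c / 2 * real k < card (F \<inter> {t..<t + k})"
      by (meson not_le)
    have "c / 2 * k \<le> card ({i. t + i \<in> F} \<inter> {..<k})" if "k \<le> K" for k
      using t[of k] that unfolding card_vimage_plus by (cases "k = 0") auto
    moreover have "(\<lambda>i. t + i \<in> F) \<in> topspace (spacing_shift P)"
      using n(2) difference_set_vimage_plus[of t F]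
      unfolding topspace_spacing_shift_iff words_def by auto
    ultimately show "\<exists>s\<in>topspace (spacing_shift P). s \<in> ?C K"
      by (intro bexI[of _ "\<lambda>i. t + i \<in> F"]) auto
  qed
  then show ?thesis by blast
qed

section \<open>Upper Banach density and dense words\<close>

abbreviation long_intervals :: "(nat \<times> nat) filter" where
  "long_intervals \<equiv>
     inf (filtercomap (\<lambda>(M, N). N - M) at_top) (principal {(M, N). 1 \<le> M})"

lemma eventually_long_intervals:
  "eventually Q long_intervals \<longleftrightarrow> (\<exists>K. \<forall>M N. 1 \<le> M \<longrightarrow> K \<le> N - M \<longrightarrow> Q (M, N))"
  unfolding eventually_inf_principal eventually_filtercomap eventually_at_top_linorder
  by (auto; blast)

text \<open>The limit superior in quantifier form. If windows of density at least \<open>c\<close>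
  stop occurring beyond some length, it is at most \<open>c\<close>; if it is below
  \<open>c\<close>, they do stop occurring.\<close>

lemma upper_banach_density_pos_iff:
  "upper_banach_density A > 0 \<longleftrightarrow>
    (\<exists>c::real>0. \<forall>K. \<exists>M N. 1 \<le> M \<and> K \<le> N - M \<and> c * real (N - M + 1) \<le> card (A \<inter> {M..N}))"
  (is "?L \<longleftrightarrow> ?R")
proof
  assume ?L
  then obtain c where c: "0 < ereal c" "ereal c < upper_banach_density A"
    using ereal_dense2 by blast
  show ?R
  proof (rule ccontr)
    assume "\<not> ?R"
    then obtain K where K: "\<And>M N. 1 \<le> M \<Longrightarrow> K \<le> N - M \<Longrightarrow>
        card (A \<inter> {M..N}) < c * real (N - M + 1)"
      using c(1) by (metis not_le ereal_less(2))
    have "upper_banach_density A \<le> ereal c"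
      unfolding upper_banach_density_def
    proof (rule Limsup_bounded, unfold eventually_long_intervals,
        intro exI[of _ K] allI impI)
      fix M N assume "1 \<le> M" "K \<le> N - M"
      then show "(case (M, N) of (M, N) \<Rightarrow>
          ereal (real (card (A \<inter> {M..N})) / real (N - M + 1))) \<le> ereal c"
        using K[of M N] by (simp add: divide_le_eq mult.commute less_imp_le)
    qed
    then show False using c(2) by simp
  qed
next
  assume ?R
  then obtain c :: real where c: "c > 0" and
    dense: "\<And>K. \<exists>M N. 1 \<le> M \<and> K \<le> N - M \<and> c * real (N - M + 1) \<le> card (A \<inter> {M..N})" by blast
  show ?L
  proof (rule ccontr)
    assume "\<not> ?L"
    then have "upper_banach_density A < ereal c"
      using c by (meson ereal_less(2) leI le_less_trans)
    then have "eventually (\<lambda>(M, N). real (card (A \<inter> {M..N})) / real (N - M + 1) < c) long_intervals"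
      unfolding upper_banach_density_def
      by (auto dest!: Limsup_lessD simp: case_prod_unfold)
    then obtain K where K: "\<And>M N. 1 \<le> M \<Longrightarrow> K \<le> N - M \<Longrightarrow>
        real (card (A \<inter> {M..N})) / real (N - M + 1) < c"
      unfolding eventually_long_intervals by auto
    obtain M N where "1 \<le> M" "K \<le> N - M" "c * real (N - M + 1) \<le> card (A \<inter> {M..N})"
      using dense by blast
    then show False using K[of M N] by (simp add: divide_less_eq mult.commute)
  qed
qed

lemma dense_words_if_banach_density_pos:
  assumes "upper_banach_density A > 0" and A: "difference_set A \<subseteq> P"
  shows "\<exists>c::real>0. \<forall>K. \<exists>n\<ge>K. \<exists>F\<in>words P n. c * n \<le> card F"
proof -
  obtain c :: real where "c > 0" and
    c: "\<And>K. \<exists>M N. 1 \<le> M \<and> K \<le> N - M \<and> c * real (N - M + 1) \<le> card (A \<inter> {M..N})"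
    using assms(1) unfolding upper_banach_density_pos_iff by blast
  have "\<exists>n\<ge>K. \<exists>F\<in>words P n. c * n \<le> card F" for K
  proof -
    \<comment> \<open>Asking for \<open>K + 1\<close> forces \<open>M < N\<close> despite truncated
      subtraction, so the window has exactly \<open>N - M + 1\<close> elements and can be moved to
      start at 0.\<close>
    obtain M N where MN: "K + 1 \<le> N - M" "c * real (N - M + 1) \<le> card (A \<inter> {M..N})"
      using c by blast
    let ?F = "{i. M + i \<in> A} \<inter> {..<N - M + 1}"
    have "{M..<M + (N - M + 1)} = {M..N}" using MN(1) by auto
    then have "card ?F = card (A \<inter> {M..N})" unfolding card_vimage_plus by simp
    moreover have "?F \<in> words P (N - M + 1)"
      using A difference_set_vimage_plus[of M A] difference_set_mono[of ?F "{i. M + i \<in> A}"]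
      unfolding words_def by auto
    ultimately show ?thesis using MN
      by (intro exI[of _ "N - M + 1"] conjI bexI[of _ ?F]) auto
  qed
  then show ?thesis using \<open>c > 0\<close> by blast
qed

lemma banach_density_pos_if_dense_words:
  fixes c :: real
  assumes "c > 0" and "\<And>K. \<exists>n\<ge>K. \<exists>F\<in>words P n. c * n \<le> card F"
  shows "\<exists>A\<subseteq>{1..}. upper_banach_density A > 0 \<and> difference_set A \<subseteq> P"
proof -
  obtain s where s: "s \<in> topspace (spacing_shift P)"
    "\<And>k. c / 2 * k \<le> card ({i. s i} \<inter> {..<k})"
    using uniformly_dense_point[OF assms] by blast
  \<comment> \<open>Positions start at 0 but the set must lie in \<open>{1..}\<close>. The bound at
    \<open>k = 1\<close> even forces \<open>s 0\<close>, so the translation by 1 is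
    essential.\<close>
  let ?A = "Suc ` {i. s i}"
  have dense: "c / 2 * (K + 1) \<le> card (?A \<inter> {1..K + 1})" for K
  proof -
    have "?A \<inter> {1..K + 1} = Suc ` ({i. s i} \<inter> {..<K + 1})" by auto
    then have "card (?A \<inter> {1..K + 1}) = card ({i. s i} \<inter> {..<K + 1})"
      by (simp add: card_image)
    then show ?thesis using s(2)[of "K + 1"] by (simp add: add.commute)
  qed
  \<comment> \<open>Windows starting at 1 are enough, because every prefix of \<open>s\<close> is
    dense.\<close>
  have "\<exists>M N. 1 \<le> M \<and> K \<le> N - M \<and> c / 2 * real (N - M + 1) \<le> card (?A \<inter> {M..N})" for K
  proof (intro exI conjI)
    show "c / 2 * real (K + 1 - 1 + 1) \<le> card (?A \<inter> {1..K + 1})" using dense[of K] by (simp add: add.commute)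
  qed auto
  then have "upper_banach_density ?A > 0"
    unfolding upper_banach_density_pos_iff using \<open>c > 0\<close> by (intro exI[of _ "c / 2"]) simp
  moreover have "difference_set ?A \<subseteq> P"
    using s(1) unfolding topspace_spacing_shift_iff difference_set_image_Suc .
  ultimately show ?thesis by (intro exI[of _ ?A]) auto
qed

theorem theorem2p1:
  fixes P :: "nat set"
  assumes "P \<subseteq> {1..}"
  shows "topological_entropy (spacing_shift P) shift = 0 \<longleftrightarrow>
    (\<exists>E\<subseteq>{1..}. density_intersective E \<and> P = {1..} - E)"
proof -
  let ?dense = "\<exists>c::real>0. \<forall>K. \<exists>n\<ge>K. \<exists>F\<in>words P n. c * n \<le> card F"
  have "topological_entropy (spacing_shift P) shift = 0 \<longleftrightarrow> \<not> ?dense"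
  proof
    assume "topological_entropy (spacing_shift P) shift = 0"
    then show "\<not> ?dense" using topological_entropy_pos by (metis less_irrefl)
  next
    assume "\<not> ?dense"
    then have "\<And>c::real. c > 0 \<Longrightarrow> \<exists>K. \<forall>n\<ge>K. \<forall>F\<in>words P n. real (card F) < c * n"
      by (meson not_le)
    then show "topological_entropy (spacing_shift P) shift = 0"
      by (intro topological_entropy_eq_0I cover_entropy_le_0)
  qed
  also have "\<dots> \<longleftrightarrow> \<not> (\<exists>A\<subseteq>{1..}. upper_banach_density A > 0 \<and> difference_set A \<subseteq> P)"
    using dense_words_if_banach_density_pos banach_density_pos_if_dense_words by metis
  \<comment> \<open>Differences are positive, so they all lie in \<open>P\<close> exactly when none
    lies in the complement of \<open>P\<close> in \<open>{1..}\<close>.\<close>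
  also have "\<dots> \<longleftrightarrow> density_intersective ({1..} - P)"
  proof -
    have "difference_set A \<subseteq> {1..}" for A unfolding difference_set_def by auto
    then have "difference_set A \<subseteq> P \<longleftrightarrow> ({1..} - P) \<inter> difference_set A = {}" for A by blast
    then show ?thesis unfolding density_intersective_def by blast
  qed
  \<comment> \<open>Complementation in \<open>{1..}\<close> is an involution, so
    \<open>{1..} - P\<close> is the only candidate for \<open>E\<close>.\<close>
  also have "\<dots> \<longleftrightarrow> (\<exists>E\<subseteq>{1..}. density_intersective E \<and> P = {1..} - E)"
    using assms by (metis Diff_subset double_diff order_refl)
  finally show ?thesis .
qed

end
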